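(* Let $\Omega$ be an algebraically closed field complete with respect to an absolute value $|\cdot|$. Let $d\ge2$, $\delta\in\Omega\setminus\{0\}$, $f_t(x)=x^d+c_1(t)x^{d-1}+\dots+c_d(t)$ with $c_i\in\Omega[t]$, $H_t(x,y)=(\delta y+f_t(x),x)$, and $\mathbf P=(a(t),b(t))\in\Omega[t]^2$. Define $A_n,B_n\in\Omega[t]$ by $A_0=a$, $A_1=\delta b+f_t(a)$, $A_{n+1}=\delta A_{n-1}+f_t(A_n)$, and $B_0=b$, $B_1=\delta^{-1}(a-f_t(b))$, $B_{n+1}=\delta^{-1}(B_{n-1}-f_t(B_n))$ for $n\ge1$. Assume that at least one of the sequences $(\deg A_n)_{n\ge0}$, $(\deg B_n)_{n\ge0}$ is unbounded. Let $\ell_n=\max\{\deg A_n,\deg A_{n-1},\deg B_{n-1},\deg B_n\}$ (which is positive for all large $n$), and for such $n$ define the metric $\|\cdot\|_n$ on $\mathcal O_{\mathbb P^1}(1)$ by $$\|a_0X_0+a_1X_1\|_n(t':t'')=\frac{|a_0t'+a_1t''|}{\max\{|A_n^{h}(t',t'')|,|A_{n-1}^{h}(t',t'')|,|B_{n-1}^{h}(t',t'')|,|B_n^{h}(t',t'')|,|t''|^{\ell_n}\}^{1/\ell_n}},$$ where for a polynomial $C$ of degree $\le\ell_n$, $C^{h}(t',t'')=t''^{\ell_n}C(t'/t'')$. Then the functions $\log\|\cdot\|_n$ converge uniformly on $\mathbb P^1(\Omega)$ as $n\to\infty$ (i.e. $\log(\|\cdot\|_n/\|\cdot\|_{\mathrm{st}})$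 converges uniformly on $\mathbb P^1(\Omega)$, where $\|a_0X_0+a_1X_1\|_{\mathrm{st}}(t':t'')=|a_0t'+a_1t''|/\max\{|t'|,|t''|\}$).
   Context: Note that for $t\in\Omega$, $\|\eta\|_n(t:1)=|a_0t+a_1|/\max\{|A_n(t)|,|A_{n-1}(t)|,|B_{n-1}(t)|,|B_n(t)|,1\}^{1/\ell_n}$, and $H_t^n(P_t)=(A_n(t),A_{n-1}(t))$, $H_t^{-n}(P_t)=(B_{n-1}(t),B_n(t))$ for $n\ge1$, where $P_t=(a(t),b(t))$. *)

theory Defs
  imports "HOL-Analysis.Analysis" "HOL-Computational_Algebra.Polynomial"
begin

section \<open>Complete absolute values\<close>

locale absolute_value =
  fixes v :: "'a::field \<Rightarrow> real"
  assumes nonneg: "0 \<le> v x"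
    and eq_0_iff: "v x = 0 \<longleftrightarrow> x = 0"
    and mult: "v (x * y) = v x * v y"
    and triangle: "v (x + y) \<le> v x + v y"
begin

lemma one [simp]: "v 1 = 1"
  using mult[of 1 1] eq_0_iff[of 1] by simp

lemma power: "v (x ^ n) = v x ^ n"
  by (induction n) (simp_all add: mult)

lemma pos: "x \<noteq> 0 \<Longrightarrow> 0 < v x"
  using nonneg[of x] eq_0_iff[of x] by linarith

lemma uminus [simp]: "v (- x) = v x"
proof -
  have "(v (-1)) ^ 2 = 1" using power[of "-1" 2] by simp
  then have "v (-1) = 1" using nonneg[of "-1"] by (simp add: power2_eq_1_iff)
  then show ?thesis using mult[of "-1" x] by simp
qed

lemma metric_space: "Metric_space UNIV (\<lambda>x y. v (x - y))"
proof
  show "v (x - y) = v (y - x)" for x y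
    using uminus[of "x - y"] by simp
  show "v (x - z) \<le> v (x - y) + v (y - z)" for x y z
    using triangle[of "x - y" "y - z"] by simp
qed (auto simp: nonneg eq_0_iff)

end

definition complete_absolute_value :: "('a::field \<Rightarrow> real) \<Rightarrow> bool" where
  "complete_absolute_value v \<longleftrightarrow>
     absolute_value v \<and> Metric_space.mcomplete UNIV (\<lambda>x y. v (x - y))"

section \<open>The family of Henon maps and the orbit of the marked point\<close>

text \<open>Only the values \<^term>\<open>c i\<close> with \<open>1 \<le> i \<le> d\<close> of the coefficient family matter.\<close>

definition fam_value :: "nat \<Rightarrow> (nat \<Rightarrow> 'a::field poly) \<Rightarrow> 'a \<Rightarrow> 'a \<Rightarrow> 'a" where
  "fam_value d c t x = x ^ d + (\<Sum>i=1..d. poly (c i) t * x ^ (d - i))"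

definition henon :: "nat \<Rightarrow> 'a::field \<Rightarrow> (nat \<Rightarrow> 'a poly) \<Rightarrow> 'a \<Rightarrow> 'a \<times> 'a \<Rightarrow> 'a \<times> 'a" where
  "henon d \<delta> c t = (\<lambda>(x, y). (\<delta> * y + fam_value d c t x, x))"

text \<open>The same polynomial family, with a polynomial in \<open>t\<close> substituted for \<open>x\<close>.\<close>

definition fam_subst :: "nat \<Rightarrow> (nat \<Rightarrow> 'a::field poly) \<Rightarrow> 'a poly \<Rightarrow> 'a poly" where
  "fam_subst d c p = p ^ d + (\<Sum>i=1..d. c i * p ^ (d - i))"

fun orbA :: "nat \<Rightarrow> 'a::field \<Rightarrow> (nat \<Rightarrow> 'a poly) \<Rightarrow> 'a poly \<Rightarrow> 'a poly \<Rightarrow> nat \<Rightarrow> 'a poly" where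
  "orbA d \<delta> c a b 0 = a"
| "orbA d \<delta> c a b (Suc 0) = smult \<delta> b + fam_subst d c a"
| "orbA d \<delta> c a b (Suc (Suc n)) =
     smult \<delta> (orbA d \<delta> c a b n) + fam_subst d c (orbA d \<delta> c a b (Suc n))"

fun orbB :: "nat \<Rightarrow> 'a::field \<Rightarrow> (nat \<Rightarrow> 'a poly) \<Rightarrow> 'a poly \<Rightarrow> 'a poly \<Rightarrow> nat \<Rightarrow> 'a poly" where
  "orbB d \<delta> c a b 0 = b"
| "orbB d \<delta> c a b (Suc 0) = smult (inverse \<delta>) (a - fam_subst d c b)"
| "orbB d \<delta> c a b (Suc (Suc n)) =
     smult (inverse \<delta>) (orbB d \<delta> c a b n - fam_subst d c (orbB d \<delta> c a b (Suc n)))"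

lemma poly_fam_subst [simp]: "poly (fam_subst d c p) t = fam_value d c t (poly p t)"
  by (simp add: fam_subst_def fam_value_def poly_sum)

lemma henon_funpow_orbA:
  "(henon d \<delta> c t ^^ Suc n) (poly a t, poly b t) =
     (poly (orbA d \<delta> c a b (Suc n)) t, poly (orbA d \<delta> c a b n) t)"
  by (induction n) (simp_all add: henon_def)

lemma inv_henon:
  assumes "\<delta> \<noteq> 0"
  shows "inv (henon d \<delta> c t) = (\<lambda>(x, y). (y, inverse \<delta> * (x - fam_value d c t y)))"
  using assms by (intro inv_unique_comp) (auto simp: fun_eq_iff henon_def simp flip: mult.assoc)

lemma henon_funpow_orbB:
  assumes "\<delta> \<noteq> 0"
  shows "(inv (henon d \<delta> c t) ^^ Suc n) (poly a t, poly b t) =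
     (poly (orbB d \<delta> c a b n) t, poly (orbB d \<delta> c a b (Suc n)) t)"
  by (induction n) (simp_all add: inv_henon[OF assms])

text \<open>The four polynomials entering \<open>\<ell>\<^sub>n\<close> and the metric; meant for \<open>n \<ge> 1\<close>.\<close>

definition orb_polys ::
  "nat \<Rightarrow> 'a::field \<Rightarrow> (nat \<Rightarrow> 'a poly) \<Rightarrow> 'a poly \<Rightarrow> 'a poly \<Rightarrow> nat \<Rightarrow> 'a poly set" where
  "orb_polys d \<delta> c a b n =
     {orbA d \<delta> c a b n, orbA d \<delta> c a b (n - 1), orbB d \<delta> c a b (n - 1), orbB d \<delta> c a b n}"

definition ell ::
  "nat \<Rightarrow> 'a::field \<Rightarrow> (nat \<Rightarrow> 'a poly) \<Rightarrow> 'a poly \<Rightarrow> 'a poly \<Rightarrow> nat \<Rightarrow> nat" where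
  "ell d \<delta> c a b n = Max (degree ` orb_polys d \<delta> c a b n)"

section \<open>The projective line and metrics on \<open>O(1)\<close>\<close>

definition proj_rel :: "(('a::field \<times> 'a) \<times> ('a \<times> 'a)) set" where
  "proj_rel = {(p, q). p \<noteq> (0, 0) \<and> (\<exists>k. k \<noteq> 0 \<and> q = (k * fst p, k * snd p))}"

definition proj_line :: "('a::field \<times> 'a) set set" where
  "proj_line = (UNIV - {(0, 0)}) // proj_rel"

lemma equiv_proj_rel: "equiv (UNIV - {(0, 0)}) (proj_rel :: (('a::field \<times> 'a) \<times> _) set)"
  (is "equiv ?U ?R")
proof (rule equivI)
  show "?R \<subseteq> ?U \<times> ?U"
    by (auto simp: proj_rel_def)
  show "refl_on ?U ?R"
    by (auto simp: refl_on_def proj_rel_def intro!: exI[of _ 1])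
  show "sym ?R"
  proof (rule symI)
    fix p q :: "'a \<times> 'a" assume "(p, q) \<in> proj_rel"
    then obtain k where "p \<noteq> (0, 0)" "k \<noteq> 0" "q = (k * fst p, k * snd p)"
      by (auto simp: proj_rel_def)
    then show "(q, p) \<in> proj_rel"
      by (auto simp: proj_rel_def prod_eq_iff intro!: exI[of _ "inverse k"])
  qed
  show "trans ?R"
  proof (rule transI)
    fix p q r :: "'a \<times> 'a" assume "(p, q) \<in> proj_rel" "(q, r) \<in> proj_rel"
    then obtain k l where "p \<noteq> (0, 0)" "k \<noteq> 0" "q = (k * fst p, k * snd p)"
      "l \<noteq> 0" "r = (l * fst q, l * snd q)"
      unfolding proj_rel_def by blast
    then show "(p, r) \<in> proj_rel"
      by (auto simp: proj_rel_def mult.assoc intro!: exI[of _ "l * k"])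
  qed
qed

text \<open>A pair \<open>(a\<^sub>0, a\<^sub>1)\<close> stands for the section \<open>a\<^sub>0 X\<^sub>0 + a\<^sub>1 X\<^sub>1\<close>; a metric
  assigns a real number to a section and homogeneous coordinates of a point.\<close>

type_synonym 'a metric_O1 = "'a \<times> 'a \<Rightarrow> 'a \<times> 'a \<Rightarrow> real"

definition lin_form :: "'a::field \<times> 'a \<Rightarrow> 'a \<times> 'a \<Rightarrow> 'a" where
  "lin_form s p = fst s * fst p + snd s * snd p"

definition metric_st :: "('a::field \<Rightarrow> real) \<Rightarrow> 'a metric_O1" where
  "metric_st v s p = v (lin_form s p) / max (v (fst p)) (v (snd p))"

text \<open>Homogenization of \<open>C\<close> in degree \<open>l \<ge> degree C\<close>, evaluated at a point; being a
  polynomial, it also makes sense for second coordinate \<open>0\<close>.\<close>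

definition hom_eval :: "nat \<Rightarrow> 'a::field poly \<Rightarrow> 'a \<times> 'a \<Rightarrow> 'a" where
  "hom_eval l C p = (\<Sum>i\<le>l. coeff C i * fst p ^ i * snd p ^ (l - i))"

lemma hom_eval_altdef:
  assumes "degree C \<le> l" "t'' \<noteq> 0"
  shows "hom_eval l C (t', t'') = t'' ^ l * poly C (t' / t'')"
proof -
  have "poly C (t' / t'') = (\<Sum>i\<le>l. coeff C i * (t' / t'') ^ i)"
    unfolding poly_altdef using assms(1)
    by (intro sum.mono_neutral_left) (auto simp: coeff_eq_0)
  then show ?thesis using assms(2)
    by (auto simp: hom_eval_def sum_distrib_left power_divide power_diff field_simps
        intro!: sum.cong)
qed

definition metric_denom ::
  "('a::field \<Rightarrow> real) \<Rightarrow> nat \<Rightarrow> 'a poly set \<Rightarrow> 'a \<times> 'a \<Rightarrow> real" where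
  "metric_denom v l S p = Max ((\<lambda>C. v (hom_eval l C p)) ` S \<union> {v (snd p) ^ l})"

definition orb_metric ::
  "('a::field \<Rightarrow> real) \<Rightarrow> nat \<Rightarrow> 'a \<Rightarrow> (nat \<Rightarrow> 'a poly) \<Rightarrow> 'a poly \<Rightarrow> 'a poly \<Rightarrow> nat
     \<Rightarrow> 'a metric_O1" where
  "orb_metric v d \<delta> c a b n s p =
     (let l = ell d \<delta> c a b n
      in v (lin_form s p) / metric_denom v l (orb_polys d \<delta> c a b n) p powr (1 / real l))"

text \<open>The function \<open>log (m / m')\<close> on the projective line, computed with any homogeneous
  coordinates of the point and any section not vanishing there.\<close>

definition log_ratio :: "'a::field metric_O1 \<Rightarrow> 'a metric_O1 \<Rightarrow> ('a \<times> 'a) set \<Rightarrow> real" where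
  "log_ratio m m' P =
     (THE r. \<forall>p\<in>P. \<forall>s. lin_form s p \<noteq> 0 \<longrightarrow> r = ln (m s p / m' s p))"

subsection \<open>Well-definedness\<close>

lemma finite_orb_polys [simp]: "finite (orb_polys d \<delta> c a b n)"
  by (simp add: orb_polys_def)

lemma hom_eval_scale: "hom_eval l C (k * x, k * y) = k ^ l * hom_eval l C (x, y)"
proof -
  have "coeff C i * (k * x) ^ i * (k * y) ^ (l - i) = k ^ l * (coeff C i * x ^ i * y ^ (l - i))"
    if "i \<le> l" for i
  proof -
    have "k ^ l = k ^ i * k ^ (l - i)" using that by (simp flip: power_add)
    then show ?thesis by (simp add: power_mult_distrib)
  qed
  then show ?thesis unfolding hom_eval_def sum_distrib_left by (auto intro!: sum.cong)
qed

context absolute_value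
begin

lemma metric_denom_nonneg: "finite S \<Longrightarrow> 0 \<le> metric_denom v l S p"
  unfolding metric_denom_def by (rule order_trans[OF _ Max_ge[where x = "v (snd p) ^ l"]])
    (simp_all add: nonneg)

lemma metric_denom_pos:
  assumes "0 < ell d \<delta> c a b n" "p \<noteq> (0, 0)"
  shows "0 < metric_denom v (ell d \<delta> c a b n) (orb_polys d \<delta> c a b n) p"
proof (cases "snd p = 0")
  case False
  let ?l = "ell d \<delta> c a b n"
  have "0 < v (snd p) ^ ?l"
    using pos[OF False] by (rule zero_less_power)
  also have "\<dots> \<le> metric_denom v ?l (orb_polys d \<delta> c a b n) p"
    unfolding metric_denom_def by (rule Max_ge) auto
  finally show ?thesis .
next
  case True
  let ?l = "ell d \<delta> c a b n"
  have "?l \<in> degree ` orb_polys d \<delta> c a b n"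
    unfolding ell_def by (rule Max_in) (auto simp: orb_polys_def)
  then obtain C where C: "C \<in> orb_polys d \<delta> c a b n" "degree C = ?l" by auto
  have "hom_eval ?l C p = (\<Sum>i\<in>{?l}. coeff C i * fst p ^ i * snd p ^ (?l - i))"
    unfolding hom_eval_def using True by (intro sum.mono_neutral_right) auto
  then have eq: "hom_eval ?l C p = coeff C ?l * fst p ^ ?l"
    by simp
  have "coeff C (degree C) \<noteq> 0"
    using assms(1) C(2) by (metis degree_0 leading_coeff_0_iff less_irrefl)
  moreover have "fst p \<noteq> 0"
    using assms(2) True by (cases p) simp
  ultimately have "hom_eval ?l C p \<noteq> 0"
    by (simp add: eq C(2))
  then have "0 < v (hom_eval ?l C p)"
    by (rule pos)
  also have "\<dots> \<le> metric_denom v ?l (orb_polys d \<delta> c a b n) p"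
    unfolding metric_denom_def using C(1) by (intro Max_ge) auto
  finally show ?thesis .
qed

lemma metric_denom_scale:
  assumes "finite S"
  shows "metric_denom v l S (k * x, k * y) = v k ^ l * metric_denom v l S (x, y)"
proof -
  let ?X = "(\<lambda>C. v (hom_eval l C (x, y))) ` S \<union> {v y ^ l}"
  have "v k ^ l * Max ?X = Max ((\<lambda>z. v k ^ l * z) ` ?X)"
    using assms by (intro mono_Max_commute) (auto intro!: monoI mult_left_mono simp: nonneg)
  also have "(\<lambda>z. v k ^ l * z) ` ?X =
      (\<lambda>C. v (hom_eval l C (k * x, k * y))) ` S \<union> {v (k * y) ^ l}"
    by (auto simp: hom_eval_scale mult power power_mult_distrib image_iff)
  finally show ?thesis by (simp add: metric_denom_def)
qed

lemma lin_form_scale: "lin_form s (k * x, k * y) = k * lin_form s (x, y)"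
  by (simp add: lin_form_def algebra_simps)

lemma orb_metric_scale:
  assumes "0 < ell d \<delta> c a b n" "k \<noteq> 0"
  shows "orb_metric v d \<delta> c a b n s (k * x, k * y) = orb_metric v d \<delta> c a b n s (x, y)"
proof -
  have "0 < v k" using assms(2) by (rule pos)
  then have "(v k ^ ell d \<delta> c a b n) powr (1 / real (ell d \<delta> c a b n)) = v k"
    using assms(1) by (simp add: powr_powr flip: powr_realpow)
  then show ?thesis using \<open>0 < v k\<close>
    by (simp add: orb_metric_def Let_def metric_denom_scale lin_form_scale mult
        powr_mult metric_denom_nonneg)
qed

lemma metric_st_scale:
  assumes "k \<noteq> 0"
  shows "metric_st v s (k * x, k * y) = metric_st v s (x, y)"
proof -
  have "0 < v k" using assms by (rule pos)
  moreover have "max (v k * v x) (v k * v y) = v k * max (v x) (v y)"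
    using \<open>0 < v k\<close> by (simp add: max_mult_distrib_left)
  ultimately show ?thesis
    by (simp add: metric_st_def lin_form_scale mult)
qed

theorem log_ratio_orb_metric:
  assumes "0 < ell d \<delta> c a b n" "P \<in> proj_line" "p \<in> P" "lin_form s p \<noteq> 0"
  shows "log_ratio (orb_metric v d \<delta> c a b n) (metric_st v) P =
           ln (orb_metric v d \<delta> c a b n s p / metric_st v s p)"
  unfolding log_ratio_def
proof (rule the_equality)
  let ?l = "ell d \<delta> c a b n"
  let ?q = "\<lambda>s p. orb_metric v d \<delta> c a b n s p / metric_st v s p"
  have eq: "?q s' p' = max (v (fst p')) (v (snd p')) /
      metric_denom v ?l (orb_polys d \<delta> c a b n) p' powr (1 / real ?l)"
    if "lin_form s' p' \<noteq> 0" for s' p'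
    using that eq_0_iff[of "lin_form s' p'"] by (simp add: orb_metric_def metric_st_def Let_def)
  show "\<forall>p'\<in>P. \<forall>s'. lin_form s' p' \<noteq> 0 \<longrightarrow> ln (?q s p) = ln (?q s' p')"
  proof (intro ballI allI impI)
    fix p' s' assume p': "p' \<in> P" and s': "lin_form s' p' \<noteq> 0"
    have "(p, p') \<in> proj_rel"
      using quotient_eq_iff[OF equiv_proj_rel, of P P p p'] assms(2,3) p'
      by (simp add: proj_line_def)
    then obtain k where k: "k \<noteq> 0" "p' = (k * fst p, k * snd p)"
      by (auto simp: proj_rel_def)
    then have "lin_form s' p \<noteq> 0"
      using s' by (auto simp: lin_form_scale)
    moreover have "?q s' p' = ?q s' p"
      using k orb_metric_scale[OF assms(1)] metric_st_scale by simp
    ultimately show "ln (?q s p) = ln (?q s' p')"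
      using eq assms(4) by metis
  qed
next
  fix r
  assume "\<forall>p'\<in>P. \<forall>s'. lin_form s' p' \<noteq> 0 \<longrightarrow>
    r = ln (orb_metric v d \<delta> c a b n s' p' / metric_st v s' p')"
  then show "r = ln (orb_metric v d \<delta> c a b n s p / metric_st v s p)"
    by (elim ballE[of _ _ p] allE[of _ s] impE) (use assms(3,4) in simp_all)
qed

end

end

theory Submission
  imports Defs
begin

text \<open>The iterates form one two-sided orbit \<open>z\<close> of polynomials with
  \<open>z (k + 1) = \<delta> z (k - 1) + f (z k)\<close>, and the four polynomials entering the metric are
  \<open>z n, z (n - 1), z (-n), z (-n - 1)\<close>. Once the largest of the four is above an escape radius,
  the orbit is growing in at least one of the two time directions, and if it grows inwards from one
  end of the window it still grows at the other end; hence the next maximum \<open>M (n + 1)\<close>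
  is comparable to \<open>M n ^ d\<close>. For degrees this gives \<open>\<ell> (n + 1) = d \<ell> n\<close>. For absolute
  values at \<open>t\<close> the escape radius grows like \<open>\<bar>t\<bar> ^ m\<close> with \<open>m\<close> bounding the degrees of the
  coefficients: it is bounded for bounded \<open>t\<close>, and for large \<open>t\<close> it is exceeded as soon as
  \<open>\<ell> n > m\<close>. So \<open>\<bar>ln M (n + 1) - d ln M n\<bar>\<close> is uniformly bounded, and dividing by
  \<open>\<ell> (n + 1)\<close> yields a geometric series.\<close>

section \<open>Escape in two-sided sequences\<close>

text \<open>For a sequence obtained from \<open>orbit\<close>, the four indices carry A_n, A_{n-1},
  B_{n-1}, B_n in this order. The order is left abstract because the escape argument is run once for
  degrees and once for absolute values.\<close>

definition window_max :: "(int \<Rightarrow> 'b::linorder) \<Rightarrow> nat \<Rightarrow> 'b" where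
  "window_max \<sigma> n =
     max (max (\<sigma> (int n)) (\<sigma> (int n - 1))) (max (\<sigma> (- int n)) (\<sigma> (- int n - 1)))"

text \<open>Of the old window only the two outer entries \<open>\<sigma> (int n)\<close> and
  \<open>\<sigma> (- int n - 1)\<close> remain; the other two are new and come from one step of the
  recurrence.\<close>

lemma window_max_Suc:
  "window_max \<sigma> (Suc n) =
     max (max (\<sigma> (int n + 1)) (\<sigma> (int n))) (max (\<sigma> (- int n - 1)) (\<sigma> (- int n - 2)))"
proof -
  have "int (Suc n) = int n + 1" "int n + 1 - 1 = int n" "- (int n + 1) = - int n - 1"
    "- int n - 1 - 1 = - int n - 2"
    by simp_all
  then show ?thesis by (simp only: window_max_def)
qed

lemma window_max_attained:
  "\<exists>k\<in>{int n, int n - 1, - int n, - int n - 1}. window_max \<sigma> n = \<sigma> k"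
  by (auto simp: window_max_def max_def split: if_splits)

text \<open>Time reversal about -1/2 exchanges the A side and the B side. The symmetry halves the
  case analysis in \<open>window_escape\<close>.\<close>

lemma window_max_reflect: "window_max (\<lambda>k. \<sigma> (- 1 - k)) n = window_max \<sigma> n"
proof -
  have "- 1 - (- int n) = int n - 1" "- 1 - (int n - 1) = - int n"
    "- 1 - int n = - int n - 1" "- 1 - (- int n - 1) = int n"
    by simp_all
  then show ?thesis
    by (simp only: window_max_def max.commute max.left_commute max.assoc)
qed

text \<open>One nondecreasing step above the radius starts an induction: since
  \<open>\<phi> x\<close> is at least \<open>x\<close> there, each forward step is again
  nondecreasing and ends above the radius.\<close>

lemma escape_forward:
  fixes \<sigma> :: "int \<Rightarrow> 'b::linorder"
  assumes fwd: "\<And>k. \<sigma> (k - 1) \<le> \<sigma> k \<Longrightarrow> R \<le> \<sigma> k \<Longrightarrow> \<phi> (\<sigma> k) \<le> \<sigma> (k + 1)"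
    and \<phi>: "\<And>x. R \<le> x \<Longrightarrow> x \<le> \<phi> x"
    and "\<sigma> (j - 1) \<le> \<sigma> j" "R \<le> \<sigma> j" "j \<le> k"
  shows "\<sigma> j \<le> \<sigma> k \<and> \<sigma> (k - 1) \<le> \<sigma> k"
  using \<open>j \<le> k\<close>
proof (induction k rule: int_ge_induct)
  case base
  then show ?case using assms by simp
next
  case (step i)
  then have "R \<le> \<sigma> i" using \<open>R \<le> \<sigma> j\<close> by auto
  then have "\<sigma> i \<le> \<sigma> (i + 1)" using fwd[of i] \<phi>[of "\<sigma> i"] step by (meson order_trans)
  then show ?case using step by auto
qed

text \<open>A maximum at the outer index dominates its inner neighbour, so one backward step leaves
  the window. A maximum at the inner index dominates its outer neighbour, so growth runs forward
  through the window and leaves at the opposite end.\<close>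

lemma window_escape_half:
  fixes \<sigma> :: "int \<Rightarrow> 'b::linorder"
  assumes fwd: "\<And>k. \<sigma> (k - 1) \<le> \<sigma> k \<Longrightarrow> R \<le> \<sigma> k \<Longrightarrow> \<phi> (\<sigma> k) \<le> \<sigma> (k + 1)"
    and bwd: "\<And>k. \<sigma> (k + 1) \<le> \<sigma> k \<Longrightarrow> R \<le> \<sigma> k \<Longrightarrow> \<phi> (\<sigma> k) \<le> \<sigma> (k - 1)"
    and \<phi>: "\<And>x. R \<le> x \<Longrightarrow> x \<le> \<phi> x"
    and R: "R \<le> window_max \<sigma> n"
    and M: "window_max \<sigma> n = \<sigma> (- int n) \<or> window_max \<sigma> n = \<sigma> (- int n - 1)"
  shows "\<phi> (window_max \<sigma> n) \<le> max (\<sigma> (int n + 1)) (\<sigma> (- int n - 2))"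
proof (cases "window_max \<sigma> n = \<sigma> (- int n - 1)")
  case True
  then have "\<sigma> (- int n) \<le> \<sigma> (- int n - 1)"
    by (metis max.cobounded1 max.cobounded2 order_trans window_max_def)
  then have "\<phi> (\<sigma> (- int n - 1)) \<le> \<sigma> (- int n - 1 - 1)"
    using True R by (intro bwd) simp_all
  moreover have "- int n - 1 - 1 = - int n - 2" by simp
  ultimately show ?thesis using True by (simp add: le_max_iff_disj del: diff_diff_eq)
next
  case False
  then have M: "window_max \<sigma> n = \<sigma> (- int n)" using M by simp
  have le: "\<sigma> (- int n - 1) \<le> window_max \<sigma> n" "\<sigma> (int n) \<le> window_max \<sigma> n"
    by (simp_all add: window_max_def le_max_iff_disj)
  \<comment> \<open>Forward escape from \<open>- int n\<close> to \<open>int n\<close>; as the start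
    is already the maximum, the value at \<open>int n\<close> must equal it.\<close>
  moreover have "\<sigma> (- int n) \<le> \<sigma> (int n) \<and> \<sigma> (int n - 1) \<le> \<sigma> (int n)"
    using R le M by (intro escape_forward[where R = R and \<phi> = \<phi>] fwd \<phi>) auto
  ultimately have "\<sigma> (int n) = window_max \<sigma> n" "\<sigma> (int n - 1) \<le> \<sigma> (int n)"
    using M by auto
  then show ?thesis using fwd[of "int n"] R by (simp add: le_max_iff_disj)
qed

text \<open>The maximum lies on the B side or on the A side. The second case is the first one for
  the reflected sequence, in which \<open>fwd\<close> and \<open>bwd\<close> trade places.\<close>

lemma window_escape:
  fixes \<sigma> :: "int \<Rightarrow> 'b::linorder"
  assumes fwd: "\<And>k. \<sigma> (k - 1) \<le> \<sigma> k \<Longrightarrow> R \<le> \<sigma> k \<Longrightarrow> \<phi> (\<sigma> k) \<le> \<sigma> (k + 1)"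
    and bwd: "\<And>k. \<sigma> (k + 1) \<le> \<sigma> k \<Longrightarrow> R \<le> \<sigma> k \<Longrightarrow> \<phi> (\<sigma> k) \<le> \<sigma> (k - 1)"
    and \<phi>: "\<And>x. R \<le> x \<Longrightarrow> x \<le> \<phi> x"
    and R: "R \<le> window_max \<sigma> n"
  shows "\<phi> (window_max \<sigma> n) \<le> window_max \<sigma> (Suc n)"
proof -
  let ?\<tau> = "\<lambda>k. \<sigma> (- 1 - k)"
  consider "window_max \<sigma> n = \<sigma> (- int n) \<or> window_max \<sigma> n = \<sigma> (- int n - 1)"
    | "window_max ?\<tau> n = ?\<tau> (- int n) \<or> window_max ?\<tau> n = ?\<tau> (- int n - 1)"
  proof -
    have "?\<tau> (- int n) = \<sigma> (int n - 1)" "?\<tau> (- int n - 1) = \<sigma> (int n)" by simp_all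
    then show ?thesis
      using window_max_attained[of n \<sigma>] that unfolding window_max_reflect by auto
  qed
  then have "\<phi> (window_max \<sigma> n) \<le> max (\<sigma> (int n + 1)) (\<sigma> (- int n - 2))"
  proof cases
    case 1
    then show ?thesis using window_escape_half[of \<sigma> R \<phi> n] assms by blast
  next
    case 2
    have "\<phi> (window_max ?\<tau> n) \<le> max (?\<tau> (int n + 1)) (?\<tau> (- int n - 2))"
    proof (rule window_escape_half[where R = R])
      show "\<phi> (?\<tau> k) \<le> ?\<tau> (k + 1)" if "?\<tau> (k - 1) \<le> ?\<tau> k" "R \<le> ?\<tau> k" for k
        using bwd[of "- 1 - k"] that by (simp add: algebra_simps)
      show "\<phi> (?\<tau> k) \<le> ?\<tau> (k - 1)" if "?\<tau> (k + 1) \<le> ?\<tau> k" "R \<le> ?\<tau> k" for k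
        using fwd[of "- 1 - k"] that by (simp add: algebra_simps)
    qed (use R \<phi> 2 in \<open>simp_all add: window_max_reflect\<close>)
    moreover have "?\<tau> (int n + 1) = \<sigma> (- int n - 2)" "?\<tau> (- int n - 2) = \<sigma> (int n + 1)"
      by (simp_all add: algebra_simps)
    ultimately show ?thesis by (simp only: window_max_reflect max.commute)
  qed
  also have "\<dots> \<le> window_max \<sigma> (Suc n)"
    unfolding window_max_Suc by (auto simp: le_max_iff_disj)
  finally show ?thesis .
qed

section \<open>The two-sided orbit and its degrees\<close>

text \<open>The shift by -1 puts the marked point at positions 0 and -1, carrying a and b, so that
  one three-term recurrence holds at every integer.\<close>

definition orbit ::
  "nat \<Rightarrow> 'a::field \<Rightarrow> (nat \<Rightarrow> 'a poly) \<Rightarrow> 'a poly \<Rightarrow> 'a poly \<Rightarrow> int \<Rightarrow> 'a poly" where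
  "orbit d \<delta> c a b k =
     (if 0 \<le> k then orbA d \<delta> c a b (nat k) else orbB d \<delta> c a b (nat (- 1 - k)))"

text \<open>The factor \<open>smult 1\<close> gives both time directions the shape \<open>\<alpha> u + \<beta> f (p)\<close>, so that
  one estimate per bound serves for both.\<close>

lemma orbit_forward:
  assumes "\<delta> \<noteq> 0"
  shows "orbit d \<delta> c a b (k + 1) =
    smult \<delta> (orbit d \<delta> c a b (k - 1)) + smult 1 (fam_subst d c (orbit d \<delta> c a b k))"
proof -
  \<comment> \<open>The indices 0 and -1 are separated because there the recurrence mixes both
    halves of the orbit.\<close>
  consider n where "k = int (Suc n)" | "k = 0" | "k = -1" | n where "k = - int n - 2"
  proof -
    have "k = int (Suc (nat (k - 1)))" if "k > 0" using that by simp
    moreover have "k = - int (nat (- k - 2)) - 2" if "k < - 1" using that by simp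
    moreover have "k > 0 \<or> k = 0 \<or> k = - 1 \<or> k < - 1" by arith
    ultimately show ?thesis using that by blast
  qed
  then show ?thesis
  proof cases
    case (1 n)
    then have "nat (k + 1) = Suc (Suc n)" "nat k = Suc n" "nat (k - 1) = n" by auto
    then show ?thesis using 1 by (simp add: orbit_def)
  next
    case 2
    then show ?thesis by (simp add: orbit_def)
  next
    case 3
    then show ?thesis using assms by (simp add: orbit_def)
  next
    case (4 n)
    then have "nat (- 1 - (k + 1)) = n" "nat (- 1 - k) = Suc n" "nat (- 1 - (k - 1)) = Suc (Suc n)"
      by auto
    then show ?thesis using 4 assms by (simp add: orbit_def)
  qed
qed

lemma orbit_backward:
  assumes "\<delta> \<noteq> 0"
  shows "orbit d \<delta> c a b (k - 1) =
    smult (inverse \<delta>) (orbit d \<delta> c a b (k + 1))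
      + smult (- inverse \<delta>) (fam_subst d c (orbit d \<delta> c a b k))"
  using assms by (simp add: orbit_forward[OF assms, of _ _ _ _ k] smult_add_right)

lemma orb_polys_orbit:
  assumes "0 < n"
  shows "orb_polys d \<delta> c a b n =
    {orbit d \<delta> c a b (int n), orbit d \<delta> c a b (int n - 1),
     orbit d \<delta> c a b (- int n), orbit d \<delta> c a b (- int n - 1)}"
proof -
  have "nat (int n - 1) = n - 1" using assms by simp
  then show ?thesis using assms by (simp add: orb_polys_def orbit_def)
qed

lemma Max_window:
  assumes "0 < n"
  shows "Max (g ` orb_polys d \<delta> c a b n) = window_max (\<lambda>k. g (orbit d \<delta> c a b k)) n"
  using assms by (simp add: orb_polys_orbit window_max_def max.assoc)

lemma ell_eq_window_max:
  "0 < n \<Longrightarrow> ell d \<delta> c a b n = window_max (\<lambda>k. degree (orbit d \<delta> c a b k)) n"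
  by (simp add: ell_def Max_window)


section \<open>Leading coefficients and growth of degrees\<close>

lemma coeff_power_degree_le:
  fixes p :: "'a::field poly"
  assumes "degree p \<le> e" "0 < d"
  shows "coeff (p ^ d) (d * e) = coeff p e ^ d"
proof (cases "degree p = e")
  case True
  then show ?thesis
    by (cases "p = 0")
      (use assms lead_coeff_power[of p d] in \<open>auto simp: degree_power_eq power_0_left\<close>)
next
  case False
  then have "degree p < e" using assms by simp
  then have "degree (p ^ d) < d * e"
    using assms degree_power_le[of p d] by (metis mult.commute mult_less_mono2 order_le_less_trans)
  then show ?thesis using \<open>degree p < e\<close> assms by (simp add: coeff_eq_0)
qed

text \<open>Since m < e, each term \<open>c i * p ^ (d - i)\<close> has degree at most m + (d - i) e
  < d e, and u stays below d e as well; only \<open>p ^ d\<close> reaches that degree. Allowing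
  degree p < e lets the coefficient formula serve at the point at infinity, where the coefficient at
  e may vanish.\<close>

lemma poly_step:
  fixes p u :: "'a::field poly"
  assumes "2 \<le> d" "\<And>i. i \<in> {1..d} \<Longrightarrow> degree (c i) \<le> m" "m < e" "degree p \<le> e" "degree u \<le> e"
  shows "degree (smult \<alpha> u + smult \<beta> (fam_subst d c p)) \<le> d * e" (is ?deg)
    and "coeff (smult \<alpha> u + smult \<beta> (fam_subst d c p)) (d * e) = \<beta> * coeff p e ^ d" (is ?coeff)
proof -
  have pow: "degree (p ^ j) \<le> j * e" for j
    using degree_power_le[of p j] assms(4)
    by (metis mult.commute mult_le_mono2 order_trans)
  define q where "q = (\<Sum>i=1..d. c i * p ^ (d - i))"
  have q: "degree q < d * e"
    unfolding q_def
  proof (rule degree_sum_less)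
    fix i assume i: "i \<in> {1..d}"
    have "degree (c i * p ^ (d - i)) \<le> m + (d - i) * e"
      using degree_mult_le[of "c i" "p ^ (d - i)"] pow[of "d - i"] assms(2)[OF i] by linarith
    also have "\<dots> < e + (d - i) * e" using assms by simp
    also have "\<dots> = (d - i + 1) * e" by simp
    also have "\<dots> \<le> d * e" using i by (intro mult_right_mono) auto
    finally show "degree (c i * p ^ (d - i)) < d * e" .
  qed (use assms in simp)
  have F: "fam_subst d c p = p ^ d + q"
    by (simp add: fam_subst_def q_def)
  have e: "e < d * e" using assms by simp
  show ?deg unfolding F
    using pow[of d] q order_trans[OF assms(5) less_imp_le[OF e]]
    by (intro degree_add_le order_trans[OF degree_smult_le]) auto
  show ?coeff unfolding F
    using q order_le_less_trans[OF assms(5) e] assms coeff_power_degree_le[of p e d]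
    by (simp add: coeff_eq_0)
qed

lemma degree_step:
  fixes p u :: "'a::field poly"
  assumes "2 \<le> d" "\<And>i. i \<in> {1..d} \<Longrightarrow> degree (c i) \<le> m" "m < degree p" "degree u \<le> degree p"
    and "\<beta> \<noteq> 0"
  shows "degree (smult \<alpha> u + smult \<beta> (fam_subst d c p)) = d * degree p"
proof (rule antisym)
  have "p \<noteq> 0" using assms(3) by auto
  then have "coeff (smult \<alpha> u + smult \<beta> (fam_subst d c p)) (d * degree p) \<noteq> 0"
    by (subst poly_step(2)[where m = m]) (use assms in auto)
  then show "d * degree p \<le> degree (smult \<alpha> u + smult \<beta> (fam_subst d c p))"
    by (rule le_degree)
qed (rule poly_step(1)[where m = m], use assms in auto)

lemma ell_Suc:
  fixes \<delta> :: "'a::field"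
  assumes "\<delta> \<noteq> 0" "2 \<le> d" "\<And>i. i \<in> {1..d} \<Longrightarrow> degree (c i) \<le> m" "0 < n"
    and m: "m < ell d \<delta> c a b n"
  shows "ell d \<delta> c a b (Suc n) = d * ell d \<delta> c a b n"
proof -
  define z where "z = orbit d \<delta> c a b"
  define \<sigma> where "\<sigma> = (\<lambda>k. degree (z k))"
  have ell: "ell d \<delta> c a b k = window_max \<sigma> k" if "0 < k" for k
    using that by (simp add: ell_eq_window_max \<sigma>_def z_def)
  note fwd = orbit_forward[OF assms(1), of d c a b, folded z_def]
  note bwd = orbit_backward[OF assms(1), of d c a b, folded z_def]
  let ?M = "window_max \<sigma> n"
  have M: "m < ?M" using m ell assms(4) by simp
  have le: "\<sigma> (int n) \<le> ?M" "\<sigma> (int n - 1) \<le> ?M" "\<sigma> (- int n) \<le> ?M" "\<sigma> (- int n - 1) \<le> ?M"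
    by (simp_all add: window_max_def le_max_iff_disj)
  \<comment> \<open>Degrees escape with radius \<open>Suc m\<close> and growth function
    multiplication by d: above m the degree of a dominating entry is multiplied exactly by
    d.\<close>
  have "d * ?M \<le> window_max \<sigma> (Suc n)"
  proof (rule window_escape[where R = "Suc m" and \<phi> = "\<lambda>x. d * x"])
    show "d * \<sigma> k \<le> \<sigma> (k + 1)" if "\<sigma> (k - 1) \<le> \<sigma> k" "Suc m \<le> \<sigma> k" for k
      using that unfolding \<sigma>_def fwd
      by (subst degree_step[where m = m]) (use assms in auto)
    show "d * \<sigma> k \<le> \<sigma> (k - 1)" if "\<sigma> (k + 1) \<le> \<sigma> k" "Suc m \<le> \<sigma> k" for k
      using that unfolding \<sigma>_def bwd
      by (subst degree_step[where m = m]) (use assms in auto)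
  qed (use assms M in auto)
  moreover have "window_max \<sigma> (Suc n) \<le> d * ?M"
  proof -
    have "\<sigma> (int n + 1) \<le> d * ?M"
      unfolding \<sigma>_def fwd
      by (rule poly_step(1)[where m = m]) (use assms M le in \<open>auto simp: \<sigma>_def\<close>)
    moreover have "\<sigma> (- int n - 1 - 1) \<le> d * ?M"
      unfolding \<sigma>_def bwd[of "- int n - 1"]
      by (rule poly_step(1)[where m = m]) (use assms M le in \<open>auto simp: \<sigma>_def\<close>)
    moreover have "1 * ?M \<le> d * ?M" using assms by (intro mult_le_mono1) simp
    then have "\<sigma> (int n) \<le> d * ?M" "\<sigma> (- int n - 1) \<le> d * ?M" using le by linarith+
    moreover have "- int n - 1 - 1 = - int n - 2" by simp
    ultimately show ?thesis
      unfolding window_max_Suc by (simp del: diff_diff_eq)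
  qed
  ultimately show ?thesis using ell assms(4) by simp
qed

text \<open>If the window degrees never exceeded m, both sequences of degrees would be bounded. Once
  they exceed m, \<open>ell_Suc\<close> multiplies them by d, so they stay above m.\<close>

lemma ell_growth:
  fixes \<delta> :: "'a::field"
  assumes "\<delta> \<noteq> 0" "2 \<le> d"
    and c: "\<And>i. i \<in> {1..d} \<Longrightarrow> degree (c i) \<le> m"
    and unbdd: "\<not> bdd_above (range (\<lambda>n. degree (orbA d \<delta> c a b n))) \<or>
         \<not> bdd_above (range (\<lambda>n. degree (orbB d \<delta> c a b n)))"
  obtains N where "0 < N" "\<And>n. N \<le> n \<Longrightarrow> m < ell d \<delta> c a b n"
    "\<And>n. N \<le> n \<Longrightarrow> ell d \<delta> c a b (Suc n) = d * ell d \<delta> c a b n"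
proof -
  have "\<exists>n>0. m < ell d \<delta> c a b n"
  proof (rule ccontr)
    assume "\<not> ?thesis"
    then have *: "ell d \<delta> c a b (Suc n) \<le> m" for n
      by (meson linorder_not_less zero_less_Suc)
    have "degree C \<le> ell d \<delta> c a b (Suc n)" if "C \<in> orb_polys d \<delta> c a b (Suc n)" for C n
      unfolding ell_def using that by (intro Max_ge) auto
    then have "degree (orbA d \<delta> c a b n) \<le> m" "degree (orbB d \<delta> c a b n) \<le> m" for n
      using order_trans[OF _ *[of n]] by (simp_all add: orb_polys_def)
    then show False using unbdd by (metis bdd_aboveI2)
  qed
  then obtain N where N: "0 < N" "m < ell d \<delta> c a b N" by blast
  have gt: "m < ell d \<delta> c a b n" if "N \<le> n" for n
    using that
  proof (induction n rule: dec_induct)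
    case (step n)
    have "ell d \<delta> c a b (Suc n) = d * ell d \<delta> c a b n"
      using step N by (intro ell_Suc[OF assms(1-2) c]) auto
    moreover have "ell d \<delta> c a b n \<le> d * ell d \<delta> c a b n"
      using mult_le_mono1[of 1 d "ell d \<delta> c a b n"] assms(2) by simp
    ultimately show ?case using step by linarith
  qed (use N in simp)
  show ?thesis
  proof (rule that[OF N(1) gt])
    show "ell d \<delta> c a b (Suc n) = d * ell d \<delta> c a b n" if "N \<le> n" for n
      using that N gt[OF that] by (intro ell_Suc[OF assms(1-2) c]) auto
  qed
qed

section \<open>Estimates for absolute values\<close>

context absolute_value
begin

section \<open>Bounds for values of polynomials\<close>

lemma zero [simp]: "v 0 = 0"
  by (simp add: eq_0_iff)

lemma sum_le: "v (\<Sum>i\<in>A. f i) \<le> (\<Sum>i\<in>A. v (f i))"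
proof (induction A rule: infinite_finite_induct)
  case (insert x F)
  then show ?case using triangle[of "f x" "sum f F"] by simp
qed simp_all

lemma inverse: "x \<noteq> 0 \<Longrightarrow> v (inverse x) = inverse (v x)"
  using mult[of x "inverse x"] by (simp add: inverse_unique)

lemma poly_upper:
  assumes "degree p \<le> m" "1 \<le> M" "v t \<le> M"
  shows "v (poly p t) \<le> (\<Sum>i\<le>degree p. v (coeff p i)) * M ^ m"
proof -
  have "v (poly p t) \<le> (\<Sum>i\<le>degree p. v (coeff p i * t ^ i))"
    unfolding poly_altdef by (rule sum_le)
  also have "\<dots> \<le> (\<Sum>i\<le>degree p. v (coeff p i) * M ^ m)"
  proof (rule sum_mono)
    fix i assume "i \<in> {..degree p}"
    then have "v t ^ i \<le> M ^ i" "M ^ i \<le> M ^ m"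
      using assms by (auto intro: power_mono power_increasing nonneg)
    then show "v (coeff p i * t ^ i) \<le> v (coeff p i) * M ^ m"
      by (auto simp: mult power intro!: mult_left_mono nonneg)
  qed
  finally show ?thesis by (simp add: sum_distrib_right)
qed

text \<open>The leading term beats the remaining terms for large t, and the strict gap between m and
  the degree leaves a spare factor of \<open>v t\<close> that absorbs any constant B.\<close>

lemma poly_lower:
  assumes "m < degree p"
  obtains T where "1 \<le> T" "\<And>t. T \<le> v t \<Longrightarrow> B * v t ^ m \<le> v (poly p t)"
proof -
  define q where "q = p - monom (lead_coeff p) (degree p)"
  define C where "C = (\<Sum>i\<le>degree q. v (coeff q i))"
  define L where "L = v (lead_coeff p)"
  have L: "0 < L" unfolding L_def using assms by (intro pos) auto
  have "degree q \<le> degree p - 1"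
    unfolding q_def by (rule coeff_0_degree_minus_1) (auto intro: degree_diff_le degree_monom_le)
  have "C \<ge> 0" unfolding C_def by (intro sum_nonneg nonneg)
  show ?thesis
  \<comment> \<open>This threshold gives \<open>L * v t\<close> at least
    \<open>\<bar>B\<bar> + C\<close>: the part C pays for the lower-order terms, the part
    \<open>\<bar>B\<bar>\<close> is the bound wanted.\<close>
  proof (rule that[of "max 1 ((\<bar>B\<bar> + C) / L)"])
    fix t assume t: "max 1 ((\<bar>B\<bar> + C) / L) \<le> v t"
    then have t1: "1 \<le> v t" and t2: "\<bar>B\<bar> + C \<le> L * v t"
      using L by (auto simp: field_simps)
    have "v (poly q t) \<le> C * v t ^ (degree p - 1)"
      unfolding C_def by (rule poly_upper) (use t1 \<open>degree q \<le> degree p - 1\<close> in auto)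
    moreover have "L * v t ^ degree p \<le> v (poly p t) + v (poly q t)"
    proof -
      have "lead_coeff p * t ^ degree p = poly p t + - poly q t"
        by (simp add: q_def poly_monom)
      then show ?thesis
        using triangle[of "poly p t" "- poly q t"] by (simp add: L_def flip: power mult)
    qed
    moreover have "L * v t ^ degree p = L * v t * v t ^ (degree p - 1)"
      using assms by (cases "degree p") auto
    moreover have "(\<bar>B\<bar> + C) * v t ^ (degree p - 1) \<le> L * v t * v t ^ (degree p - 1)"
      using t1 t2 by (intro mult_right_mono) auto
    moreover have "B * v t ^ m \<le> \<bar>B\<bar> * v t ^ (degree p - 1)"
      using t1 assms by (intro mult_mono power_increasing) auto
    ultimately show "B * v t ^ m \<le> v (poly p t)"
      by (simp add: algebra_simps)
  qed simp
qed

section \<open>One step of the recurrence in absolute value\<close>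

lemma fam_value_diff:
  assumes "(\<Sum>i=1..d. v (poly (c i) t)) \<le> r" "1 \<le> M" "v x \<le> M"
  shows "v (fam_value d c t x - x ^ d) \<le> r * M ^ (d - 1)"
proof -
  have "v (fam_value d c t x - x ^ d) \<le> (\<Sum>i=1..d. v (poly (c i) t * x ^ (d - i)))"
    by (simp add: fam_value_def sum_le)
  also have "\<dots> \<le> (\<Sum>i=1..d. v (poly (c i) t) * M ^ (d - 1))"
  proof (rule sum_mono)
    fix i assume "i \<in> {1..d}"
    then have "v x ^ (d - i) \<le> M ^ (d - i)" "M ^ (d - i) \<le> M ^ (d - 1)"
      using assms by (auto intro: power_mono power_increasing nonneg)
    then show "v (poly (c i) t * x ^ (d - i)) \<le> v (poly (c i) t) * M ^ (d - 1)"
      by (auto simp: mult power intro!: mult_left_mono nonneg)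
  qed
  also have "\<dots> \<le> r * M ^ (d - 1)"
    using assms by (auto simp flip: sum_distrib_right intro!: mult_right_mono)
  finally show ?thesis .
qed

text \<open>The parameter e compares the size r of the coefficients with M: the lower-order part r
  M^(d-1) is then at most e M^d.\<close>

lemma step_upper:
  assumes "0 < d" "(\<Sum>i=1..d. v (poly (c i) t)) \<le> r" "1 \<le> M" "v x \<le> M" "v u \<le> M" "r \<le> e * M"
  shows "v (\<alpha> * u + \<beta> * fam_value d c t x) \<le> (v \<alpha> + v \<beta> * (1 + e)) * M ^ d"
proof -
  let ?F = "fam_value d c t x"
  have M: "M * M ^ (d - 1) = M ^ d" using assms(1) by (cases d) auto
  have "v ?F \<le> v (?F - x ^ d) + v (x ^ d)"
    using triangle[of "?F - x ^ d" "x ^ d"] by simp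
  also have "\<dots> \<le> r * M ^ (d - 1) + M ^ d"
    using fam_value_diff[OF assms(2-4)] assms(4)
    by (auto simp: power intro!: add_mono power_mono nonneg)
  also have "r * M ^ (d - 1) \<le> e * M * M ^ (d - 1)"
    using assms by (intro mult_right_mono) auto
  finally have "v ?F \<le> (1 + e) * M ^ d" by (simp add: algebra_simps flip: M)
  moreover have "M \<le> M ^ d" using assms by (intro self_le_power) auto
  moreover have "v (\<alpha> * u + \<beta> * ?F) \<le> v \<alpha> * v u + v \<beta> * v ?F"
    using triangle[of "\<alpha> * u" "\<beta> * ?F"] by (simp add: mult)
  moreover have "v \<alpha> * v u \<le> v \<alpha> * M ^ d" if "v u \<le> M ^ d"
    using that by (intro mult_left_mono nonneg)
  moreover have "v \<beta> * v ?F \<le> v \<beta> * ((1 + e) * M ^ d)" if "v ?F \<le> (1 + e) * M ^ d"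
    using that by (intro mult_left_mono nonneg)
  ultimately show ?thesis using assms by (simp add: algebra_simps)
qed

text \<open>The error terms \<open>\<alpha> * u\<close> and \<open>\<beta> * (f x - x ^ d)\<close>
  together are at most (|\<alpha>| + |\<beta>|) r X^(d-1) with X = \<open>v x\<close>. The condition
  on K and \<open>K * r \<le> v x\<close> bound this by half of the main term |\<beta>| X^d.\<close>

lemma step_lower:
  assumes "2 \<le> d" "(\<Sum>i=1..d. v (poly (c i) t)) \<le> r" "1 \<le> r" "1 \<le> K" "K * r \<le> v x"
    and "v u \<le> v x" "2 * (v \<alpha> + v \<beta>) \<le> K * v \<beta>"
  shows "v \<beta> / 2 * v x ^ d \<le> v (\<alpha> * u + \<beta> * fam_value d c t x)"
proof -
  let ?F = "fam_value d c t x" and ?X = "v x"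
  have "1 * r \<le> K * r" using assms by (intro mult_right_mono) auto
  then have X: "1 \<le> ?X" "r \<le> ?X" using assms by linarith+
  have "\<beta> * x ^ d = (\<alpha> * u + \<beta> * ?F) + (- (\<alpha> * u) + - (\<beta> * (?F - x ^ d)))"
    by (simp add: algebra_simps)
  then have "v (\<beta> * x ^ d) \<le> v (\<alpha> * u + \<beta> * ?F) + (v (\<alpha> * u) + v (\<beta> * (?F - x ^ d)))"
    using triangle[of "\<alpha> * u + \<beta> * ?F" "- (\<alpha> * u) + - (\<beta> * (?F - x ^ d))"]
      triangle[of "- (\<alpha> * u)" "- (\<beta> * (?F - x ^ d))"] by (simp del: uminus_add_conv_diff)
  then have main: "v \<beta> * ?X ^ d \<le> v (\<alpha> * u + \<beta> * ?F) + (v \<alpha> * v u + v \<beta> * v (?F - x ^ d))"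
    by (simp add: mult power)
  have "v \<beta> * v (?F - x ^ d) \<le> v \<beta> * (r * ?X ^ (d - 1))"
    using fam_value_diff[OF assms(2) X(1)] by (intro mult_left_mono nonneg) auto
  moreover have "v \<alpha> * v u \<le> v \<alpha> * (r * ?X ^ (d - 1))"
  proof (intro mult_left_mono nonneg)
    have "?X \<le> ?X ^ (d - 1)" using X assms(1) by (intro self_le_power) auto
    also have "\<dots> \<le> r * ?X ^ (d - 1)" using X assms mult_right_mono[of 1 r "?X ^ (d - 1)"] by simp
    finally show "v u \<le> r * ?X ^ (d - 1)" using assms by simp
  qed
  moreover have "2 * (v \<alpha> + v \<beta>) * (r * ?X ^ (d - 1)) \<le> K * v \<beta> * (r * ?X ^ (d - 1))"
    using assms X by (intro mult_right_mono) auto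
  moreover have "v \<beta> * (K * r) * ?X ^ (d - 1) \<le> v \<beta> * ?X ^ d"
  proof -
    have "v \<beta> * (K * r) * ?X ^ (d - 1) \<le> v \<beta> * ?X * ?X ^ (d - 1)"
      using assms X by (intro mult_right_mono mult_left_mono nonneg) auto
    also have "\<dots> = v \<beta> * ?X ^ d" using assms(1) by (cases d) auto
    finally show ?thesis .
  qed
  ultimately show ?thesis using main by (simp add: algebra_simps)
qed

text \<open>The constant \<open>2 * esc \<delta>\<close> is large enough for \<open>step_lower\<close> in both time directions.\<close>

definition esc :: "'a \<Rightarrow> real" where
  "esc \<delta> = 2 * (1 + v \<delta> + inverse (v \<delta>))"

lemma esc_bounds:
  assumes "\<delta> \<noteq> 0"
  shows "2 \<le> esc \<delta>" "inverse (esc \<delta>) \<le> 1 / 2" "inverse (esc \<delta>) \<le> inverse (v \<delta>) / 2"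
    "2 * (v \<delta> + 1) \<le> 2 * esc \<delta>" "4 * inverse (v \<delta>) \<le> 2 * esc \<delta> * inverse (v \<delta>)"
    "v \<delta> + 1 \<le> esc \<delta>" "2 * inverse (v \<delta>) \<le> esc \<delta>"
proof -
  have p: "0 < v \<delta>" using assms by (rule pos)
  then have "0 < inverse (v \<delta>)" by simp
  with p show "2 \<le> esc \<delta>" "2 * (v \<delta> + 1) \<le> 2 * esc \<delta>" "v \<delta> + 1 \<le> esc \<delta>"
    "2 * inverse (v \<delta>) \<le> esc \<delta>"
    by (simp_all add: esc_def)
  then show "inverse (esc \<delta>) \<le> 1 / 2" by (simp add: field_simps)
  have "2 * v \<delta> \<le> esc \<delta>" using p by (simp add: esc_def)
  then have "inverse (esc \<delta>) \<le> inverse (2 * v \<delta>)" using p by (intro le_imp_inverse_le) auto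
  then show "inverse (esc \<delta>) \<le> inverse (v \<delta>) / 2" by (simp add: field_simps)
  show "4 * inverse (v \<delta>) \<le> 2 * esc \<delta> * inverse (v \<delta>)"
    using p \<open>2 \<le> esc \<delta>\<close> by (intro mult_right_mono) auto
qed

section \<open>Heights of the window at a fixed parameter t\<close>

context
  fixes d :: nat and \<delta> :: 'a and c :: "nat \<Rightarrow> 'a poly" and a b :: "'a poly"
    and t :: 'a
begin

definition "size_at k = v (poly (orbit d \<delta> c a b k) t)"

text \<open>The entry 1 is the term |t''|^(ell_n) of the metric in the coordinates (t, 1). It also
  makes every height at least 1.\<close>

definition "height n = max (window_max size_at n) 1"

context
  fixes r :: real
  assumes delta: "\<delta> \<noteq> 0" and d: "2 \<le> d"
    and r: "(\<Sum>i=1..d. v (poly (c i) t)) \<le> r" "1 \<le> r"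
begin

lemma size_at_forward:
  "size_at (k + 1) = v (\<delta> * poly (orbit d \<delta> c a b (k - 1)) t
     + 1 * fam_value d c t (poly (orbit d \<delta> c a b k) t))"
  unfolding size_at_def by (subst orbit_forward[OF delta]) simp

lemma size_at_backward:
  "size_at (k - 1) = v (inverse \<delta> * poly (orbit d \<delta> c a b (k + 1)) t
     + (- inverse \<delta>) * fam_value d c t (poly (orbit d \<delta> c a b k) t))"
  unfolding size_at_def by (subst orbit_backward[OF delta]) simp

text \<open>Only the two new outer entries need \<open>step_upper\<close>; the surviving ones are
  bounded by the old height. In \<open>height_compare\<close>, e is a constant for bounded t and 1
  for large t.\<close>

lemma height_upper:
  assumes e: "r \<le> e * height n" "1 \<le> e"
  shows "height (Suc n) \<le> esc \<delta> * (1 + e) * height n ^ d"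
proof -
  let ?M = "height n"
  have M: "1 \<le> ?M" by (simp add: height_def)
  have le: "size_at (int n) \<le> ?M" "size_at (int n - 1) \<le> ?M"
    "size_at (- int n) \<le> ?M" "size_at (- int n - 1) \<le> ?M"
    by (simp_all add: height_def window_max_def le_max_iff_disj)
  note D = esc_bounds[OF delta]
  have pd: "0 < v \<delta>" using delta by (rule pos)
  have C: "1 * ?M ^ d \<le> esc \<delta> * (1 + e) * ?M ^ d"
    using M e(2) D(1) mult_mono[of 1 "esc \<delta>" 1 "1 + e"] by (intro mult_right_mono) auto
  have "?M \<le> ?M ^ d" using M d by (intro self_le_power) auto
  then have "?M \<le> esc \<delta> * (1 + e) * ?M ^ d" using C by simp
  moreover have "size_at (int n + 1) \<le> esc \<delta> * (1 + e) * ?M ^ d"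
  proof -
    have "size_at (int n + 1) \<le> (v \<delta> + v 1 * (1 + e)) * ?M ^ d"
      unfolding size_at_forward
      by (rule step_upper) (use d r e M le in \<open>auto simp: size_at_def\<close>)
    also have "\<dots> \<le> ((v \<delta> + 1) * (1 + e)) * ?M ^ d"
      using M e pd by (intro mult_right_mono) (auto simp: algebra_simps)
    also have "\<dots> \<le> (esc \<delta> * (1 + e)) * ?M ^ d"
      using M e D by (intro mult_right_mono) auto
    finally show ?thesis .
  qed
  moreover have "size_at (- int n - 1 - 1) \<le> esc \<delta> * (1 + e) * ?M ^ d"
  proof -
    have "size_at (- int n - 1 - 1) \<le> (v (inverse \<delta>) + v (- inverse \<delta>) * (1 + e)) * ?M ^ d"
      unfolding size_at_backward[of "- int n - 1"]
      by (rule step_upper) (use d r e M le in \<open>auto simp: size_at_def\<close>)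
    also have "\<dots> \<le> (2 * inverse (v \<delta>) * (1 + e)) * ?M ^ d"
      using M e pd by (intro mult_right_mono) (auto simp: algebra_simps inverse[OF delta])
    also have "\<dots> \<le> (esc \<delta> * (1 + e)) * ?M ^ d"
      using M e D by (intro mult_right_mono) auto
    finally show ?thesis .
  qed
  moreover have "- int n - 1 - 1 = - int n - 2" by simp
  ultimately show ?thesis
    unfolding height_def[of "Suc n"] window_max_Suc using le M
    by (simp del: diff_diff_eq)
qed

text \<open>Above the escape radius x^(d-1) is at least x, hence at least
  \<open>esc \<delta>\<close>. This supplies the condition on \<phi> in
  \<open>window_escape\<close>.\<close>

lemma escape_power:
  assumes "2 * esc \<delta> * r \<le> x"
  shows "x \<le> inverse (esc \<delta>) * x ^ d"
proof -
  note D = esc_bounds(1)[OF delta]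
  have "2 * esc \<delta> * 1 \<le> 2 * esc \<delta> * r" using D r(2) by (intro mult_left_mono) auto
  then have x: "esc \<delta> \<le> x" "1 \<le> x" using assms D by linarith+
  then have "x ^ 1 \<le> x ^ (d - 1)" using d by (intro power_increasing) auto
  then have "esc \<delta> * x \<le> x ^ (d - 1) * x" using x by (intro mult_right_mono) auto
  also have "\<dots> = x ^ d" using d by (cases d) auto
  finally show ?thesis using D by (simp add: field_simps)
qed

text \<open>This is \<open>window_escape\<close> for absolute values, with \<open>step_lower\<close>
  giving growth in both directions. The second conclusion lets the escape condition propagate to all
  later n.\<close>

lemma height_lower:
  assumes R: "2 * esc \<delta> * r \<le> height n"
  shows "height n ^ d \<le> esc \<delta> * height (Suc n)"
    and "2 * esc \<delta> * r \<le> height (Suc n)"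
proof -
  note D = esc_bounds[OF delta]
  have pd: "0 < v \<delta>" using delta by (rule pos)
  \<comment> \<open>The radius exceeds 1, so a height above it is attained by the orbit and not by
    the extra entry 1.\<close>
  have R1: "1 < 2 * esc \<delta> * r"
    using D(1) r(2) mult_left_mono[of 1 r "2 * esc \<delta>"] by linarith
  then have "window_max size_at n = height n"
    using R by (auto simp: height_def max_def split: if_splits)
  moreover have "inverse (esc \<delta>) * window_max size_at n ^ d \<le> window_max size_at (Suc n)"
  proof (rule window_escape[where R = "2 * esc \<delta> * r" and \<phi> = "\<lambda>x. inverse (esc \<delta>) * x ^ d"])
    fix k assume k: "size_at (k - 1) \<le> size_at k" "2 * esc \<delta> * r \<le> size_at k"
    have "inverse (esc \<delta>) * size_at k ^ d \<le> v 1 / 2 * size_at k ^ d"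
      using D by (intro mult_right_mono) (auto simp: size_at_def nonneg)
    also have "\<dots> \<le> size_at (k + 1)"
      unfolding size_at_forward unfolding size_at_def
      by (rule step_lower[where K = "2 * esc \<delta>" and r = r])
        (use d r D k in \<open>auto simp: size_at_def\<close>)
    finally show "inverse (esc \<delta>) * size_at k ^ d \<le> size_at (k + 1)" .
  next
    fix k assume k: "size_at (k + 1) \<le> size_at k" "2 * esc \<delta> * r \<le> size_at k"
    have "inverse (esc \<delta>) * size_at k ^ d \<le> v (- inverse \<delta>) / 2 * size_at k ^ d"
      using D by (intro mult_right_mono) (auto simp: size_at_def nonneg inverse[OF delta])
    also have "\<dots> \<le> size_at (k - 1)"
      unfolding size_at_backward unfolding size_at_def
      by (rule step_lower[where K = "2 * esc \<delta>" and r = r])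
        (use d r D k in \<open>auto simp: size_at_def inverse[OF delta]\<close>)
    finally show "inverse (esc \<delta>) * size_at k ^ d \<le> size_at (k - 1)" .
  qed (use escape_power R calculation in auto)
  ultimately have *: "inverse (esc \<delta>) * height n ^ d \<le> height (Suc n)"
    by (simp add: height_def[of "Suc n"])
  then show "height n ^ d \<le> esc \<delta> * height (Suc n)" using D(1) by (simp add: field_simps)
  show "2 * esc \<delta> * r \<le> height (Suc n)" using * escape_power[OF R] R by linarith
qed

end

end

section \<open>The denominator of the metric at affine points and at infinity\<close>

lemma metric_denom_affine:
  assumes "0 < n"
  shows "metric_denom v (ell d \<delta> c a b n) (orb_polys d \<delta> c a b n) (t, 1) =
    height d \<delta> c a b t n"
proof -
  let ?l = "ell d \<delta> c a b n" and ?S = "orb_polys d \<delta> c a b n"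
  have "v (hom_eval ?l C (t, 1)) = v (poly C t)" if "C \<in> ?S" for C
  proof -
    have "degree C \<le> ?l" unfolding ell_def using that by (intro Max_ge) auto
    then show ?thesis by (simp add: hom_eval_altdef)
  qed
  then have "(\<lambda>C. v (hom_eval ?l C (t, 1))) ` ?S = (\<lambda>C. v (poly C t)) ` ?S"
    by (rule image_cong[OF refl])
  moreover have "?S \<noteq> {}" by (simp add: orb_polys_def)
  ultimately show ?thesis
    using assms
    by (simp add: metric_denom_def height_def size_at_def[abs_def] Max_window max.commute)
qed

lemma hom_eval_infinity: "hom_eval l C (1, 0) = coeff C l"
proof -
  \<comment> \<open>The term i = l survives because \<open>0 ^ 0 = 1\<close>; all others contain a
    positive power of 0.\<close>
  have "hom_eval l C (1, 0) = (\<Sum>i\<in>{l}. coeff C i * 1 ^ i * 0 ^ (l - i))"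
    unfolding hom_eval_def fst_conv snd_conv by (rule sum.mono_neutral_right) auto
  then show ?thesis by simp
qed

lemma metric_denom_infinity:
  assumes "0 < n" "0 < ell d \<delta> c a b n"
  shows "metric_denom v (ell d \<delta> c a b n) (orb_polys d \<delta> c a b n) (1, 0) =
    window_max (\<lambda>k. v (coeff (orbit d \<delta> c a b k) (ell d \<delta> c a b n))) n"
proof -
  have "orb_polys d \<delta> c a b n \<noteq> {}" by (simp add: orb_polys_def)
  moreover have "0 \<le> window_max (\<lambda>k. v (coeff (orbit d \<delta> c a b k) (ell d \<delta> c a b n))) n"
    by (simp add: window_max_def le_max_iff_disj nonneg)
  ultimately show ?thesis
    using assms
    by (simp add: metric_denom_def hom_eval_infinity Max_window zero_power)
qed

text \<open>At (1 : 0) the denominator sees only coefficients in degree \<open>ell\<close>, and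
  \<open>poly_step\<close> turns the recurrence into exact power laws for the two outer
  entries.\<close>

lemma metric_denom_infinity_Suc:
  fixes \<delta> c a b
  assumes "\<delta> \<noteq> 0" "2 \<le> d" and c: "\<And>i. i \<in> {1..d} \<Longrightarrow> degree (c i) \<le> m"
    and "0 < n" "m < ell d \<delta> c a b n"
  defines "A \<equiv> \<lambda>n. v (coeff (orbit d \<delta> c a b (int n)) (ell d \<delta> c a b n))"
    and "B \<equiv> \<lambda>n. v (coeff (orbit d \<delta> c a b (- int n - 1)) (ell d \<delta> c a b n))"
  shows "A (Suc n) = A n ^ d" "B (Suc n) = inverse (v \<delta>) * B n ^ d"
    "metric_denom v (ell d \<delta> c a b (Suc n)) (orb_polys d \<delta> c a b (Suc n)) (1, 0) =
       max (A (Suc n)) (B (Suc n))"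
proof -
  let ?l = "ell d \<delta> c a b" and ?z = "orbit d \<delta> c a b"
  have l: "?l (Suc n) = d * ?l n" by (rule ell_Suc[OF assms(1,2) c]) (use assms in auto)
  then have lt: "?l n < ?l (Suc n)" using assms by auto
  have deg: "degree (?z (int n)) \<le> ?l n" "degree (?z (int n - 1)) \<le> ?l n"
    "degree (?z (- int n)) \<le> ?l n" "degree (?z (- int n - 1)) \<le> ?l n"
    using assms(4) by (simp_all add: ell_eq_window_max window_max_def le_max_iff_disj)
  have "coeff (?z (int n + 1)) (?l (Suc n)) = 1 * coeff (?z (int n)) (?l n) ^ d"
    unfolding l orbit_forward[OF assms(1)]
    by (rule poly_step(2)[where m = m]) (use assms deg in auto)
  then show A: "A (Suc n) = A n ^ d" by (simp add: A_def power add.commute)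
  have "coeff (?z (- int n - 1 - 1)) (?l (Suc n)) = - inverse \<delta> * coeff (?z (- int n - 1)) (?l n) ^ d"
    unfolding l orbit_backward[OF assms(1), of _ _ _ _ "- int n - 1"]
    by (rule poly_step(2)[where m = m]) (use assms deg in auto)
  moreover have idx: "- int n - 1 - 1 = - int (Suc n) - 1" "- int n - 2 = - int (Suc n) - 1"
    "int n + 1 = int (Suc n)" by simp_all
  ultimately show B: "B (Suc n) = inverse (v \<delta>) * B n ^ d"
    by (simp only: B_def mult uminus power inverse[OF assms(1)])
  have "metric_denom v (?l (Suc n)) (orb_polys d \<delta> c a b (Suc n)) (1, 0) =
      window_max (\<lambda>k. v (coeff (?z k) (?l (Suc n)))) (Suc n)"
    by (rule metric_denom_infinity) (use lt in auto)
  also have "\<dots> = max (max (A (Suc n)) 0) (max 0 (B (Suc n)))"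
  proof -
    \<comment> \<open>The entries kept from the old window have degree at most ell_n, which is less
      than ell_{n+1}.\<close>
    have "coeff (?z (int n)) (?l (Suc n)) = 0" "coeff (?z (- int n - 1)) (?l (Suc n)) = 0"
      using deg lt by (auto intro!: coeff_eq_0)
    then show ?thesis unfolding window_max_Suc idx A_def B_def by simp
  qed
  finally show "metric_denom v (?l (Suc n)) (orb_polys d \<delta> c a b (Suc n)) (1, 0) =
       max (A (Suc n)) (B (Suc n))"
    by (simp only: A_def B_def nonneg max.absorb1 max.absorb2)
qed

text \<open>The description as a maximum of two outer entries is available at successor indices, so
  the comparison starts there. The factor \<open>esc \<delta>\<close> dominates 1,
  \<open>v \<delta>\<close> and its inverse, which absorbs the asymmetry between the two power
  laws.\<close>

lemma metric_denom_infinity_compare: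
  assumes "\<delta> \<noteq> 0" "2 \<le> d" and c: "\<And>i. i \<in> {1..d} \<Longrightarrow> degree (c i) \<le> m"
    and "0 < n" "m < ell d \<delta> c a b n" "m < ell d \<delta> c a b (Suc n)"
  defines "W \<equiv> \<lambda>n. metric_denom v (ell d \<delta> c a b n) (orb_polys d \<delta> c a b n) (1, 0)"
  shows "W (Suc n) ^ d \<le> esc \<delta> * W (Suc (Suc n)) \<and> W (Suc (Suc n)) \<le> esc \<delta> * W (Suc n) ^ d"
proof -
  define A where "A = v (coeff (orbit d \<delta> c a b (int (Suc n))) (ell d \<delta> c a b (Suc n)))"
  define B where "B = v (coeff (orbit d \<delta> c a b (- int (Suc n) - 1)) (ell d \<delta> c a b (Suc n)))"
  have W1: "W (Suc n) = max A B"
    unfolding W_def A_def B_def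
    by (rule metric_denom_infinity_Suc(3)[where m = m]) (use assms in auto)
  note S = metric_denom_infinity_Suc[where c = c and n = "Suc n", OF assms(1,2) c,
    folded A_def B_def]
  have W2: "W (Suc (Suc n)) = max (A ^ d) (inverse (v \<delta>) * B ^ d)"
    unfolding W_def using S[where a = a and b = b] assms(6) by (simp add: A_def B_def)
  have AB: "0 \<le> A" "0 \<le> B" by (simp_all add: A_def B_def nonneg)
  note D = esc_bounds[OF assms(1)]
  have pd: "0 < v \<delta>" using assms(1) by (rule pos)
  have "A ^ d \<le> esc \<delta> * A ^ d" using D(1) AB mult_right_mono[of 1 "esc \<delta>" "A ^ d"] by simp
  also have "\<dots> \<le> esc \<delta> * W (Suc (Suc n))" using D(1) W2 by (intro mult_left_mono) auto
  finally have 1: "A ^ d \<le> esc \<delta> * W (Suc (Suc n))" .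
  have "B ^ d = v \<delta> * (inverse (v \<delta>) * B ^ d)" using pd by simp
  also have "\<dots> \<le> esc \<delta> * W (Suc (Suc n))"
    using D(1,6) W2 pd AB by (intro mult_mono) auto
  finally have 2: "B ^ d \<le> esc \<delta> * W (Suc (Suc n))" .
  have "A ^ d \<le> W (Suc n) ^ d" "B ^ d \<le> W (Suc n) ^ d"
    using AB W1 by (auto intro!: power_mono)
  moreover have "0 \<le> W (Suc n) ^ d" using AB W1 by auto
  then have "1 * W (Suc n) ^ d \<le> esc \<delta> * W (Suc n) ^ d"
    using D(1) by (intro mult_right_mono) auto
  moreover have "inverse (v \<delta>) * B ^ d \<le> esc \<delta> * W (Suc n) ^ d"
    using D(7) calculation pd AB inverse_positive_iff_positive[of "v \<delta>"]
    by (intro mult_mono) (auto simp del: inverse_positive_iff_positive)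
  ultimately have "W (Suc (Suc n)) \<le> esc \<delta> * W (Suc n) ^ d" using W2 by simp
  moreover have "W (Suc n) ^ d \<le> esc \<delta> * W (Suc (Suc n))"
    using 1 2 W1 by (auto simp: max_def)
  ultimately show ?thesis by simp
qed

text \<open>The constant is uniform in t because of a split at |t| = T. For bounded t the escape
  radius is bounded, so heights below it cost only a constant; for larger t the window at N already
  exceeds its radius and keeps doing so.\<close>

lemma height_compare:
  assumes "\<delta> \<noteq> 0" "2 \<le> d" and c: "\<And>i. i \<in> {1..d} \<Longrightarrow> degree (c i) \<le> m"
    and N: "0 < N" "m < ell d \<delta> c a b N"
  obtains E where "\<And>n t. N \<le> n \<Longrightarrow>
    height d \<delta> c a b t n ^ d \<le> E * height d \<delta> c a b t (Suc n) \<and>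
    height d \<delta> c a b t (Suc n) \<le> E * height d \<delta> c a b t n ^ d"
proof -
  define C where "C = 1 + (\<Sum>i=1..d. \<Sum>j\<le>degree (c i). v (coeff (c i) j))"
  have C1: "1 \<le> C" unfolding C_def by (auto intro!: sum_nonneg nonneg)
  have C: "(\<Sum>i=1..d. v (poly (c i) t)) \<le> C * M ^ m" "1 \<le> C * M ^ m"
    if "1 \<le> M" "v t \<le> M" for t M
  proof -
    have M: "1 \<le> M ^ m" using that by simp
    have "(\<Sum>i=1..d. v (poly (c i) t))
        \<le> (\<Sum>i=1..d. (\<Sum>j\<le>degree (c i). v (coeff (c i) j)) * M ^ m)"
      using that c by (intro sum_mono poly_upper) auto
    also have "\<dots> \<le> C * M ^ m"
      using M by (simp add: C_def distrib_right flip: sum_distrib_right)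
    finally show "(\<Sum>i=1..d. v (poly (c i) t)) \<le> C * M ^ m" .
    show "1 \<le> C * M ^ m" using C1 M mult_mono[of 1 C 1 "M ^ m"] by simp
  qed
  have "ell d \<delta> c a b N \<in> degree ` orb_polys d \<delta> c a b N"
    unfolding ell_def by (rule Max_in) (auto simp: orb_polys_def)
  \<comment> \<open>A window polynomial of degree above m outgrows the escape radius, which is of
    order |t|^m; \<open>poly_lower\<close> then fixes T.\<close>
  then obtain p where p: "p \<in> orb_polys d \<delta> c a b N" "m < degree p" using N by auto
  note D = esc_bounds(1)[OF assms(1)]
  obtain T where T: "1 \<le> T" "\<And>t. T \<le> v t \<Longrightarrow> 2 * esc \<delta> * C * v t ^ m \<le> v (poly p t)"
    using poly_lower[OF p(2), of "2 * esc \<delta> * C"] by blast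
  define R where "R = C * T ^ m"
  have R: "1 \<le> R" unfolding R_def using C(2)[of T 0] T(1) by simp
  \<comment> \<open>The summands cover the upper bounds with e = R and e = 1, the lower bound
    \<open>esc \<delta>\<close>, and the d-th power of any height below the radius for bounded
    t.\<close>
  define E where "E = esc \<delta> * (2 + R) + (2 * esc \<delta> * R) ^ d"
  have E: "esc \<delta> \<le> E" "esc \<delta> * (1 + 1) \<le> E" "esc \<delta> * (1 + R) \<le> E" "(2 * esc \<delta> * R) ^ d \<le> E"
  proof -
    have "0 \<le> (2 * esc \<delta> * R) ^ d" "0 \<le> esc \<delta> * R" using D R by auto
    then show "esc \<delta> \<le> E" "esc \<delta> * (1 + 1) \<le> E" "esc \<delta> * (1 + R) \<le> E" "(2 * esc \<delta> * R) ^ d \<le> E"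
      using D by (simp_all add: E_def algebra_simps)
  qed
  show ?thesis
  proof (rule that[of E])
    fix n t assume n: "N \<le> n"
    let ?h = "height d \<delta> c a b t"
    have h1: "1 \<le> ?h k" for k by (simp add: height_def)
    have lowE: "?h n ^ d \<le> E * ?h (Suc n)" if "?h n ^ d \<le> x * ?h (Suc n)" "x \<le> E" for x
      using that h1[of "Suc n"] mult_right_mono[of x E "?h (Suc n)"] by linarith
    have upE: "?h (Suc n) \<le> E * ?h n ^ d" if "?h (Suc n) \<le> x * ?h n ^ d" "x \<le> E" for x
      using that one_le_power[OF h1, of n d] mult_right_mono[of x E "?h n ^ d"] by linarith
    show "?h n ^ d \<le> E * ?h (Suc n) \<and> ?h (Suc n) \<le> E * ?h n ^ d"
    proof (cases "v t \<le> T")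
      case True
      note r = C[OF T(1) True, folded R_def]
      have "R \<le> R * ?h n" using R h1[of n] mult_left_mono[of 1 "?h n" R] by simp
      then have up: "?h (Suc n) \<le> esc \<delta> * (1 + R) * ?h n ^ d"
        using R by (intro height_upper[OF assms(1,2) r]) auto
      show ?thesis
      proof (cases "2 * esc \<delta> * R \<le> ?h n")
        case True
        then show ?thesis
          using height_lower(1)[OF assms(1,2) r True] up lowE upE E by blast
      next
        case False
        then have "?h n ^ d \<le> (2 * esc \<delta> * R) ^ d" using h1[of n] by (intro power_mono) auto
        also have "\<dots> \<le> (2 * esc \<delta> * R) ^ d * ?h (Suc n)"
          using D R h1[of "Suc n"] mult_left_mono[of 1 "?h (Suc n)" "(2 * esc \<delta> * R) ^ d"] by simp
        finally show ?thesis using up lowE upE E by blast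
      qed
    next
      case False
      then have t: "T \<le> v t" "1 \<le> v t" using T by auto
      note r = C[OF t(2) order_refl]
      \<comment> \<open>The polynomial p gives the bound at N, and \<open>height_lower(2)\<close>
        carries it to later indices with the same radius.\<close>
      have large: "2 * esc \<delta> * (C * v t ^ m) \<le> ?h k" if "N \<le> k" for k
        using that
      proof (induction k rule: dec_induct)
        case base
        have "2 * esc \<delta> * (C * v t ^ m) \<le> v (poly p t)" using T(2)[OF t(1)] by (simp add: mult.assoc)
        also have "\<dots> \<le> Max ((\<lambda>q. v (poly q t)) ` orb_polys d \<delta> c a b N)"
          using p by (intro Max_ge) auto
        also have "\<dots> \<le> ?h N" using N by (simp add: Max_window height_def size_at_def[abs_def])
        finally show ?case .
      next
        case (step k)
        then show ?case using height_lower(2)[OF assms(1,2) r] by blast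
      qed
      have "1 * (C * v t ^ m) \<le> 2 * esc \<delta> * (C * v t ^ m)"
        using D r(2) by (intro mult_right_mono) auto
      then have "C * v t ^ m \<le> 1 * ?h n" using large[OF n] by linarith
      then have "?h (Suc n) \<le> esc \<delta> * (1 + 1) * ?h n ^ d"
        by (intro height_upper[OF assms(1,2) r]) auto
      then show ?thesis
        using height_lower(1)[OF assms(1,2) r large[OF n]] lowE upE E by blast
    qed
  qed
qed

lemma log_ratio_normalized:
  assumes "0 < ell d \<delta> c a b n" "P \<in> proj_line" "p \<in> P" "p \<in> range (\<lambda>t. (t, 1)) \<union> {(1, 0)}"
  shows "log_ratio (orb_metric v d \<delta> c a b n) (metric_st v) P =
    ln (max (v (fst p)) (v (snd p)))
      - ln (metric_denom v (ell d \<delta> c a b n) (orb_polys d \<delta> c a b n) p) / ell d \<delta> c a b n"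
proof -
  let ?D = "metric_denom v (ell d \<delta> c a b n) (orb_polys d \<delta> c a b n) p"
  \<comment> \<open>The section X_1 works at (t, 1) and X_0 at (1, 0); its value cancels in the
    ratio anyway.\<close>
  obtain s where s: "lin_form s p = 1"
    using assms(4) by (auto simp: lin_form_def intro: that[of "(0, 1)"] that[of "(1, 0)"])
  have p0: "p \<noteq> (0, 0)" using assms(4) by auto
  then have D: "0 < ?D" by (rule metric_denom_pos[OF assms(1)])
  have m: "0 < max (v (fst p)) (v (snd p))"
    using p0 by (cases p) (auto simp: less_max_iff_disj intro: pos)
  have "log_ratio (orb_metric v d \<delta> c a b n) (metric_st v) P =
      ln (orb_metric v d \<delta> c a b n s p / metric_st v s p)"
    using assms s by (intro log_ratio_orb_metric) auto
  also have "\<dots> = ln (max (v (fst p)) (v (snd p)) / ?D powr (1 / ell d \<delta> c a b n))"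
    by (simp add: orb_metric_def metric_st_def s Let_def)
  also have "\<dots> = ln (max (v (fst p)) (v (snd p))) - ln ?D / ell d \<delta> c a b n"
    using D m by (simp add: ln_div ln_powr)
  finally show ?thesis .
qed

end

section \<open>Uniform convergence on the projective line\<close>

lemma proj_line_normalized:
  assumes "P \<in> proj_line"
  shows "\<exists>p\<in>P. p \<in> range (\<lambda>t. (t, 1)) \<union> {(1, 0)}"
proof -
  obtain x y where xy: "(x, y) \<noteq> (0, 0)" "P = proj_rel `` {(x, y)}"
    using assms by (auto simp: proj_line_def elim!: quotientE)
  show ?thesis
  proof (cases "y = 0")
    case True
    then have "((x, y), (1, 0)) \<in> proj_rel"
      using xy by (auto simp: proj_rel_def intro!: exI[of _ "inverse x"])
    then show ?thesis using xy by blast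
  next
    case False
    then have "((x, y), (inverse y * x, 1)) \<in> proj_rel"
      by (auto simp: proj_rel_def intro!: exI[of _ "inverse y"])
    then show ?thesis using xy by blast
  qed
qed

text \<open>The increments from N on telescope, and the Weierstrass M-test sums them against the
  geometric series.\<close>

lemma uniformly_convergent_on_geometric:
  fixes f :: "nat \<Rightarrow> 'b \<Rightarrow> real"
  assumes "\<And>n x. N \<le> n \<Longrightarrow> x \<in> S \<Longrightarrow> \<bar>f (Suc n) x - f n x\<bar> \<le> C * (1 / 2) ^ (n - N)"
  shows "uniformly_convergent_on S f"
proof -
  let ?g = "\<lambda>n x. f (Suc (n + N)) x - f (n + N) x"
  have "uniformly_convergent_on S (\<lambda>n x. \<Sum>i<n. ?g i x)"
  proof (rule Weierstrass_m_test')
    show "norm (?g n x) \<le> C * (1 / 2) ^ n" if "x \<in> S" for n x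
      using assms[of "n + N" x] that by simp
  qed (intro summable_mult summable_geometric, simp)
  moreover have "(\<Sum>i<n. ?g i x) = f (n + N) x - f N x" for n x
    using sum_lessThan_telescope[of "\<lambda>n. f (n + N) x" n] by simp
  ultimately obtain l where l: "uniform_limit S (\<lambda>n x. f (n + N) x - f N x) l sequentially"
    by (auto simp: uniformly_convergent_on_def)
  have "uniform_limit S f (\<lambda>x. l x + f N x) sequentially"
    unfolding uniform_limit_sequentially_iff
  proof (intro allI impI)
    fix e :: real assume "0 < e"
    then obtain M where M: "\<And>n x. M \<le> n \<Longrightarrow> x \<in> S \<Longrightarrow> dist (f (n + N) x - f N x) (l x) < e"
      using l unfolding uniform_limit_sequentially_iff by blast
    have "dist (f n x) (l x + f N x) < e" if "M + N \<le> n" "x \<in> S" for n x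
      using M[of "n - N" x] that by (simp add: dist_real_def algebra_simps)
    then show "\<exists>M. \<forall>n\<ge>M. \<forall>x\<in>S. dist (f n x) (l x + f N x) < e" by blast
  qed
  then show ?thesis by (auto simp: uniformly_convergent_on_def)
qed

theorem theorem2p1:
  fixes v :: "'a::alg_closed_field \<Rightarrow> real"
    and d :: nat and \<delta> :: 'a and c :: "nat \<Rightarrow> 'a poly" and a b :: "'a poly"
  assumes "complete_absolute_value v"
    and "d \<ge> 2"
    and "\<delta> \<noteq> 0"
    and "\<not> bdd_above (range (\<lambda>n. degree (orbA d \<delta> c a b n))) \<or>
         \<not> bdd_above (range (\<lambda>n. degree (orbB d \<delta> c a b n)))"
  shows "(\<forall>\<^sub>F n in sequentially. 0 < ell d \<delta> c a b n) \<and>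
         uniformly_convergent_on proj_line
           (\<lambda>n. log_ratio (orb_metric v d \<delta> c a b n) (metric_st v))"
proof -
  interpret absolute_value v
    using assms(1) by (simp add: complete_absolute_value_def)
  let ?l = "ell d \<delta> c a b"
  define m where "m = (\<Sum>i=1..d. degree (c i))"
  have c: "degree (c i) \<le> m" if "i \<in> {1..d}" for i
    unfolding m_def using that by (intro member_le_sum) auto
  obtain N where N: "0 < N" "\<And>n. N \<le> n \<Longrightarrow> m < ?l n" "\<And>n. N \<le> n \<Longrightarrow> ?l (Suc n) = d * ?l n"
    using ell_growth[OF assms(3,2) c assms(4)] by blast
  obtain E where E: "\<And>n t. N \<le> n \<Longrightarrow>
      height d \<delta> c a b t n ^ d \<le> E * height d \<delta> c a b t (Suc n) \<and>
      height d \<delta> c a b t (Suc n) \<le> E * height d \<delta> c a b t n ^ d"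
    using height_compare[OF assms(3,2) c N(1) N(2)[OF order_refl]] by blast
  define W where "W = (\<lambda>n. metric_denom v (?l n) (orb_polys d \<delta> c a b n))"
  define K where "K = max E (esc \<delta>)"
  have K: "2 \<le> K" using esc_bounds(1)[OF assms(3)] by (simp add: K_def)
  have W0: "0 < W n p" if "N \<le> n" "p \<noteq> (0, 0)" for n p
    unfolding W_def using that N(2)[of n] by (intro metric_denom_pos) auto
  \<comment> \<open>Both kinds of points share the constant K; the start \<open>Suc N\<close> comes
    from the comparison at infinity.\<close>
  have W: "W n p ^ d \<le> K * W (Suc n) p \<and> W (Suc n) p \<le> K * W n p ^ d"
    if n: "Suc N \<le> n" and p: "p \<in> range (\<lambda>t. (t, 1)) \<union> {(1, 0)}" for n p
  proof -
    have "\<exists>E\<le>K. W n p ^ d \<le> E * W (Suc n) p \<and> W (Suc n) p \<le> E * W n p ^ d"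
    proof (cases "p = (1, 0)")
      case True
      obtain n' where n': "n = Suc n'" "N \<le> n'" using n by (cases n) auto
      show ?thesis
        unfolding W_def True n'(1)
        using metric_denom_infinity_compare[where c = c and n = n', OF assms(3,2) c] n' N(1,2)
        by (intro exI[of _ "esc \<delta>"]) (simp add: K_def)
    next
      case False
      then obtain t where t: "p = (t, 1)" using p by auto
      show ?thesis
        unfolding W_def t using E[of n t] n N(1)
        by (intro exI[of _ E]) (simp add: metric_denom_affine K_def)
    qed
    then obtain E where E: "E \<le> K" "W n p ^ d \<le> E * W (Suc n) p" "W (Suc n) p \<le> E * W n p ^ d"
      by blast
    have "p \<noteq> (0, 0)" using p by auto
    then have "0 \<le> W (Suc n) p" "0 \<le> W n p ^ d"
      using W0[of "Suc n" p] W0[of n p] n by auto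
    then have "E * W (Suc n) p \<le> K * W (Suc n) p" "E * W n p ^ d \<le> K * W n p ^ d"
      using E(1) by (simp_all add: mult_right_mono)
    then show ?thesis using E by linarith
  qed
  \<comment> \<open>Multiplication by d, at least 2, from a positive starting value makes the
    denominators geometric.\<close>
  have growth: "2 ^ (n - Suc N) \<le> ?l n" if "Suc N \<le> n" for n
    using that
  proof (induction n rule: dec_induct)
    case base
    then show ?case using N(2)[of "Suc N"] by simp
  next
    case (step n)
    have "2 * 2 ^ (n - Suc N) \<le> d * ?l n" using step assms(2) by (intro mult_mono) auto
    moreover have "n - N = Suc (n - Suc N)" using step by simp
    ultimately show ?case using N(3)[of n] step by simp
  qed
  have "uniformly_convergent_on proj_line
     (\<lambda>n. log_ratio (orb_metric v d \<delta> c a b n) (metric_st v))"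
  proof (rule uniformly_convergent_on_geometric[where N = "Suc N" and C = "ln K"])
    fix n and P :: "('a \<times> 'a) set"
    assume n: "Suc N \<le> n" and P: "P \<in> proj_line"
    obtain p where p: "p \<in> P" "p \<in> range (\<lambda>t. (t, 1)) \<union> {(1, 0)}"
      using proj_line_normalized[OF P] by blast
    have p0: "p \<noteq> (0, 0)" using p by auto
    let ?x = "W n p" and ?y = "W (Suc n) p"
    have xy: "0 < ?x" "0 < ?y" using W0 p0 n by auto
    have l: "0 < ?l n" "?l (Suc n) = d * ?l n" using N(2)[of n] N(3)[of n] n by simp_all
    then have l': "0 < ?l (Suc n)" using assms(2) by simp
    have "ln (?x ^ d) \<le> ln (K * ?y)" "ln ?y \<le> ln (K * ?x ^ d)"
      using W[OF n p(2)] xy K by simp_all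
    then have ln: "\<bar>ln ?y - d * ln ?x\<bar> \<le> ln K"
      using xy K by (simp add: ln_mult ln_realpow abs_le_iff)
    have "\<bar>log_ratio (orb_metric v d \<delta> c a b (Suc n)) (metric_st v) P
        - log_ratio (orb_metric v d \<delta> c a b n) (metric_st v) P\<bar> = \<bar>ln ?x / ?l n - ln ?y / ?l (Suc n)\<bar>"
      using log_ratio_normalized[OF l(1) P p] log_ratio_normalized[OF l' P p] by (simp add: W_def)
    \<comment> \<open>The standard-metric term does not depend on n and has cancelled. Since
      ell_{n+1} = d ell_n, the common denominator exposes exactly the quantity bounded by
      \<open>ln K\<close>.\<close>
    also have "ln ?x / ?l n - ln ?y / ?l (Suc n) = - (ln ?y - d * ln ?x) / ?l (Suc n)"
      using l assms(2) by (simp add: field_simps)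
    also have "\<bar>\<dots>\<bar> \<le> ln K / ?l (Suc n)"
      using ln l' by (simp add: abs_divide abs_minus_commute divide_right_mono)
    also have "\<dots> \<le> ln K / 2 ^ (n - Suc N)"
    proof (rule divide_left_mono)
      have "2 ^ (n - Suc N) \<le> ?l n" by (rule growth[OF n])
      also have "\<dots> \<le> ?l (Suc n)" using l assms(2) by simp
      finally show "2 ^ (n - Suc N) \<le> real (?l (Suc n))"
        by (metis of_nat_le_iff of_nat_numeral of_nat_power)
    qed (use K l' in auto)
    finally show "\<bar>log_ratio (orb_metric v d \<delta> c a b (Suc n)) (metric_st v) P
        - log_ratio (orb_metric v d \<delta> c a b n) (metric_st v) P\<bar> \<le> ln K * (1 / 2) ^ (n - Suc N)"
      by (simp add: power_divide)
  qed
  moreover have "\<forall>\<^sub>F n in sequentially. 0 < ?l n"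
    unfolding eventually_sequentially using N(2) by (metis gr_zeroI not_less0)
  ultimately show ?thesis by blast
qed

end
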